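(* Consider the Full Multigrid Scheme described in the context, run on $\vartheta$ computing nodes. Assume that solving the semilinear elliptic problems in the low dimensional spaces $V_{H,h_k}$ ($k=2,\dots,n$) and in $V_{h_1}$ needs work $\mathcal{O}(M_H)$ and $\mathcal{O}(M_{h_1})$, respectively, and that the work of the multigrid iteration for the linear boundary value problem in each level space $V_{h_k}$ is $\mathcal{O}(N_k)$ for $k=2,3,\dots,n$, where $N_k=\dim V_{h_k}$. Let $\varpi$ denote the number of nonlinear iterations used when solving each semilinear problem in $V_{H,h_k}$. Then, in each computing node, the work involved in the Full Multigrid Scheme satisfies $$\text{Total work}=\mathcal{O}\Big(\big(1+\tfrac{\varpi}{\vartheta}\big)N_n+M_H\log N_n+M_{h_1}\Big).$$
   Context: **Problem.** $\Omega\subset\mathbb{R}^d$ ($d=2,3$) is a bounded convex Lipschitz domain, $V=H_0^1(\Omega)$, $a(w,v)=(\mathcal{A}\nabla w,\nabla v)$ with $\mathcal{A}$ a symmetric positive definite matrix function with entries in $W^{1,\infty}(\Omega)$, and the problem is: find $u\in V$ with $a(u,v)+(f(x,u),v)=(g,v)$ for all $v\in V$, where $f$ is nonlinear in its second argument with $(f(x,w)-f(x,v),w-v)\ge0$ and $(f(x,w)-f(x,v),\phi)\le C_f\|w-v\|_0\|\phi\|_1$ for all $w,v,\phi\in V$. Write $\|w\|_a=\sqrt{a(w,w)}$. **Spaces.** $V_H\subseteq V_{h_1}\subset\cdots\subset V_{h_n}\subset V$ are nested linear finite element spaces on a coarse mesh $\mathcal{T}_H$ and on meshes $\mathcal{T}_{h_k}$,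 where $\mathcal{T}_{h_1}$ is a regular refinement of $\mathcal{T}_H$ and $\mathcal{T}_{h_k}$ is one regular refinement of $\mathcal{T}_{h_{k-1}}$ (each element giving $\beta^d$ subelements, $h_k=h_{k-1}/\beta$, $\beta>1$ fixed). The dimensions $N_k=\dim V_{h_k}$ satisfy $N_k\approx\beta^{-d(n-k)}N_n$, $k=1,\dots,n$, with constants of equivalence independent of $k$ and $n$. **Full Multigrid Scheme.** (1) Solve the semilinear problem in $V_{h_1}$: find $u_{h_1}\in V_{h_1}$ with $a(u_{h_1},v)+(f(x,u_{h_1}),v)=(g,v)$ for all $v\in V_{h_1}$. (2) For $k=2,\dots,n$: set $u_{h_k}^{(0)}=u_{h_{k-1}}$, perform $p$ correction steps ($\ell=0,\dots,p-1$) and set $u_{h_k}=u_{h_k}^{(p)}$. One correction step $u_{h_k}^{(\ell)}\mapsto u_{h_k}^{(\ell+1)}$ consists of: (a) performing $m$ multigrid iterations, with initial value $u_{h_k}^{(\ell)}$, for the linear problem of finding $\widehat u\in V_{h_k}$ with $a(\widehat u,v)=-(f(x,u_{h_k}^{(\ell)}),v)+(g,v)$ for all $v\in V_{h_k}$, yielding $\widetilde u_{h_k}^{(\ell+1)}\in V_{h_k}$ with $\|\widetilde u_{h_k}^{(\ell+1)}-\widehat u\|_a\le\theta\|u_{h_k}^{(\ell)}-\widehat u\|_a$, $\theta<1$ fixed independently of the mesh sizes; (b) solving, by a nonlinear iteration, the semilinear problem of finding $u_{h_k}^{(\ell+1)}\in V_{H,h_k}:=V_H+\mathrm{span}\{\widetilde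 u_{h_k}^{(\ell+1)}\}$ with $a(u_{h_k}^{(\ell+1)},v)+(f(x,u_{h_k}^{(\ell+1)}),v)=(g,v)$ for all $v\in V_{H,h_k}$. The numbers $m$ and $p$ are fixed. **Cost model.** In each nonlinear iteration step for the problem in $V_{H,h_k}$ the matrix on $V_{H,h_k}$ must be assembled, which costs $\mathcal{O}(N_k)$ in total; this assembly is done in parallel without data transfer over the $\vartheta$ nodes, so that it costs $\mathcal{O}(N_k/\vartheta)$ per node and per nonlinear iteration. This assembly cost is counted in addition to the solving cost $\mathcal{O}(M_H)$. All $\mathcal{O}$-constants are independent of $k$ and $n$, and the estimate is asymptotic in $n$. *)

theory Defs
  imports "HOL-Analysis.Analysis" "HOL-Library.Function_Algebras"
begin

interpretation fun_space: vector_space "\<lambda>c (u :: 'a \<Rightarrow> real) x. c * u x"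
  by standard (auto simp: fun_eq_iff algebra_simps)

section \<open>Sobolev spaces\<close>

text \<open>Elements of Sobolev spaces are represented by functions on the whole space;
  only their values on \<open>\<Omega>\<close> matter.\<close>

definition partial_deriv :: "'d \<Rightarrow> (real^'d \<Rightarrow> real) \<Rightarrow> real^'d::finite \<Rightarrow> real" where
  "partial_deriv i \<phi> x = frechet_derivative \<phi> (at x) (axis i 1)"

fun C_k :: "nat \<Rightarrow> (real^'d::finite \<Rightarrow> real) \<Rightarrow> bool" where
  "C_k 0 \<phi> \<longleftrightarrow> continuous_on UNIV \<phi>"
| "C_k (Suc k) \<phi> \<longleftrightarrow> (\<forall>x. \<phi> differentiable (at x)) \<and> (\<forall>i. C_k k (partial_deriv i \<phi>))"

definition test_function :: "(real^'d::finite) set \<Rightarrow> (real^'d \<Rightarrow> real) \<Rightarrow> bool" where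
  "test_function \<Omega> \<phi> \<longleftrightarrow> (\<forall>k. C_k k \<phi>) \<and>
     compact (closure {x. \<phi> x \<noteq> 0}) \<and> closure {x. \<phi> x \<noteq> 0} \<subseteq> \<Omega>"

definition locally_integrable :: "(real^'d::finite) set \<Rightarrow> (real^'d \<Rightarrow> real) \<Rightarrow> bool" where
  "locally_integrable \<Omega> u \<longleftrightarrow> (\<forall>K. compact K \<and> K \<subseteq> \<Omega> \<longrightarrow> integrable (lebesgue_on K) u)"

definition has_weak_grad ::
  "(real^'d::finite) set \<Rightarrow> (real^'d \<Rightarrow> real) \<Rightarrow> (real^'d \<Rightarrow> real^'d) \<Rightarrow> bool" where
  "has_weak_grad \<Omega> u G \<longleftrightarrow>
     locally_integrable \<Omega> u \<and> (\<forall>i. locally_integrable \<Omega> (\<lambda>x. G x $ i)) \<and>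
     (\<forall>\<phi> i. test_function \<Omega> \<phi> \<longrightarrow>
        integral\<^sup>L (lebesgue_on \<Omega>) (\<lambda>x. u x * partial_deriv i \<phi> x) =
        - integral\<^sup>L (lebesgue_on \<Omega>) (\<lambda>x. G x $ i * \<phi> x))"

text \<open>The weak gradient is unique almost everywhere on \<open>\<Omega>\<close>, so the choice is immaterial
  under integrals.\<close>

definition weak_grad ::
  "(real^'d::finite) set \<Rightarrow> (real^'d \<Rightarrow> real) \<Rightarrow> real^'d \<Rightarrow> real^'d" where
  "weak_grad \<Omega> u = (SOME G. has_weak_grad \<Omega> u G)"

definition in_L2 :: "(real^'d::finite) set \<Rightarrow> (real^'d \<Rightarrow> real) \<Rightarrow> bool" where
  "in_L2 \<Omega> u \<longleftrightarrow> u \<in> borel_measurable (lebesgue_on \<Omega>) \<and>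
     integrable (lebesgue_on \<Omega>) (\<lambda>x. (u x)\<^sup>2)"

definition in_Linf :: "(real^'d::finite) set \<Rightarrow> (real^'d \<Rightarrow> real) \<Rightarrow> bool" where
  "in_Linf \<Omega> u \<longleftrightarrow> u \<in> borel_measurable (lebesgue_on \<Omega>) \<and>
     (\<exists>B. AE x in lebesgue_on \<Omega>. \<bar>u x\<bar> \<le> B)"

definition H1 :: "(real^'d::finite) set \<Rightarrow> (real^'d \<Rightarrow> real) set" where
  "H1 \<Omega> = {u. in_L2 \<Omega> u \<and> (\<exists>G. has_weak_grad \<Omega> u G \<and> (\<forall>i. in_L2 \<Omega> (\<lambda>x. G x $ i)))}"

definition W1inf :: "(real^'d::finite) set \<Rightarrow> (real^'d \<Rightarrow> real) set" where
  "W1inf \<Omega> = {u. in_Linf \<Omega> u \<and> (\<exists>G. has_weak_grad \<Omega> u G \<and> (\<forall>i. in_Linf \<Omega> (\<lambda>x. G x $ i)))}"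

definition inner0 ::
  "(real^'d::finite) set \<Rightarrow> (real^'d \<Rightarrow> real) \<Rightarrow> (real^'d \<Rightarrow> real) \<Rightarrow> real" where
  "inner0 \<Omega> u v = integral\<^sup>L (lebesgue_on \<Omega>) (\<lambda>x. u x * v x)"

definition norm0 :: "(real^'d::finite) set \<Rightarrow> (real^'d \<Rightarrow> real) \<Rightarrow> real" where
  "norm0 \<Omega> u = sqrt (inner0 \<Omega> u u)"

definition norm1 :: "(real^'d::finite) set \<Rightarrow> (real^'d \<Rightarrow> real) \<Rightarrow> real" where
  "norm1 \<Omega> u = sqrt ((norm0 \<Omega> u)\<^sup>2 +
     integral\<^sup>L (lebesgue_on \<Omega>) (\<lambda>x. weak_grad \<Omega> u x \<bullet> weak_grad \<Omega> u x))"

definition H10 :: "(real^'d::finite) set \<Rightarrow> (real^'d \<Rightarrow> real) set" where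
  "H10 \<Omega> = {u \<in> H1 \<Omega>. \<exists>\<phi> :: nat \<Rightarrow> real^'d \<Rightarrow> real.
     (\<forall>j. test_function \<Omega> (\<phi> j)) \<and> (\<lambda>j. norm1 \<Omega> (u - \<phi> j)) \<longlonglongrightarrow> 0}"


section \<open>The semilinear elliptic problem\<close>

definition lipschitz_boundary :: "(real^'d::finite) set \<Rightarrow> bool" where
  "lipschitz_boundary \<Omega> \<longleftrightarrow>
     (\<forall>x\<in>frontier \<Omega>. \<exists>r>0. \<exists>e L. \<exists>\<gamma> :: real^'d \<Rightarrow> real. norm e = 1 \<and> L-lipschitz_on UNIV \<gamma> \<and>
        \<Omega> \<inter> ball x r = {y \<in> ball x r. \<gamma> (y - (y \<bullet> e) *\<^sub>R e) < y \<bullet> e})"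

definition convex_lipschitz_domain :: "(real^'d::finite) set \<Rightarrow> bool" where
  "convex_lipschitz_domain \<Omega> \<longleftrightarrow>
     open \<Omega> \<and> \<Omega> \<noteq> {} \<and> bounded \<Omega> \<and> convex \<Omega> \<and> lipschitz_boundary \<Omega>"

definition admissible_coefficient ::
  "(real^'d::finite) set \<Rightarrow> (real^'d \<Rightarrow> real^'d^'d) \<Rightarrow> bool" where
  "admissible_coefficient \<Omega> A \<longleftrightarrow>
     (\<forall>x\<in>\<Omega>. transpose (A x) = A x \<and> (\<forall>\<xi>. \<xi> \<noteq> 0 \<longrightarrow> 0 < (A x *v \<xi>) \<bullet> \<xi>)) \<and>
     (\<forall>i j. (\<lambda>x. A x $ i $ j) \<in> W1inf \<Omega>)"

text \<open>The integrability conditions say that the pairings \<open>(f(x,w),\<phi>)\<close> and \<open>(g,\<phi>)\<close> are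
  meaningful; without them the Bochner integral would silently be zero.\<close>

definition admissible_nonlinearity ::
  "(real^'d::finite) set \<Rightarrow> (real^'d \<Rightarrow> real \<Rightarrow> real) \<Rightarrow> bool" where
  "admissible_nonlinearity \<Omega> f \<longleftrightarrow>
     (\<forall>w\<in>H10 \<Omega>. \<forall>\<phi>\<in>H10 \<Omega>. integrable (lebesgue_on \<Omega>) (\<lambda>x. f x (w x) * \<phi> x)) \<and>
     (\<forall>w\<in>H10 \<Omega>. \<forall>v\<in>H10 \<Omega>. 0 \<le> inner0 \<Omega> (\<lambda>x. f x (w x) - f x (v x)) (w - v)) \<and>
     (\<exists>C\<^sub>f. \<forall>w\<in>H10 \<Omega>. \<forall>v\<in>H10 \<Omega>. \<forall>\<phi>\<in>H10 \<Omega>.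
        inner0 \<Omega> (\<lambda>x. f x (w x) - f x (v x)) \<phi> \<le> C\<^sub>f * norm0 \<Omega> (w - v) * norm1 \<Omega> \<phi>)"

definition admissible_source :: "(real^'d::finite) set \<Rightarrow> (real^'d \<Rightarrow> real) \<Rightarrow> bool" where
  "admissible_source \<Omega> g \<longleftrightarrow> (\<forall>\<phi>\<in>H10 \<Omega>. integrable (lebesgue_on \<Omega>) (\<lambda>x. g x * \<phi> x))"

definition energy_form ::
  "(real^'d::finite) set \<Rightarrow> (real^'d \<Rightarrow> real^'d^'d) \<Rightarrow>
     (real^'d \<Rightarrow> real) \<Rightarrow> (real^'d \<Rightarrow> real) \<Rightarrow> real" where
  "energy_form \<Omega> A w v =
     integral\<^sup>L (lebesgue_on \<Omega>) (\<lambda>x. (A x *v weak_grad \<Omega> w x) \<bullet> weak_grad \<Omega> v x)"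

definition energy_norm ::
  "(real^'d::finite) set \<Rightarrow> (real^'d \<Rightarrow> real^'d^'d) \<Rightarrow> (real^'d \<Rightarrow> real) \<Rightarrow> real" where
  "energy_norm \<Omega> A w = sqrt (energy_form \<Omega> A w w)"

definition semilinear_solution ::
  "(real^'d::finite) set \<Rightarrow> (real^'d \<Rightarrow> real^'d^'d) \<Rightarrow> (real^'d \<Rightarrow> real \<Rightarrow> real) \<Rightarrow>
     (real^'d \<Rightarrow> real) \<Rightarrow> (real^'d \<Rightarrow> real) set \<Rightarrow> (real^'d \<Rightarrow> real) \<Rightarrow> bool" where
  "semilinear_solution \<Omega> A f g U u \<longleftrightarrow> u \<in> U \<and>
     (\<forall>v\<in>U. energy_form \<Omega> A u v + inner0 \<Omega> (\<lambda>x. f x (u x)) v = inner0 \<Omega> g v)"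

text \<open>\<open>linearised_solution \<Omega> A f g U w u\<close>: the linear problem with the nonlinear term
  frozen at \<open>w\<close>.\<close>

definition linearised_solution ::
  "(real^'d::finite) set \<Rightarrow> (real^'d \<Rightarrow> real^'d^'d) \<Rightarrow> (real^'d \<Rightarrow> real \<Rightarrow> real) \<Rightarrow>
     (real^'d \<Rightarrow> real) \<Rightarrow> (real^'d \<Rightarrow> real) set \<Rightarrow> (real^'d \<Rightarrow> real) \<Rightarrow> (real^'d \<Rightarrow> real) \<Rightarrow> bool" where
  "linearised_solution \<Omega> A f g U w u \<longleftrightarrow> u \<in> U \<and>
     (\<forall>v\<in>U. energy_form \<Omega> A u v = - inner0 \<Omega> (\<lambda>x. f x (w x)) v + inner0 \<Omega> g v)"


section \<open>Meshes and linear finite element spaces\<close>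

text \<open>A mesh is a conforming triangulation into full-dimensional simplices. It is only
  required to lie in the closure of \<open>\<Omega>\<close>: a general convex domain is not a polytope, and
  if it is one then the case \<open>\<Union>T = closure \<Omega>\<close> is included.\<close>

definition mesh_in :: "(real^'d::finite) set \<Rightarrow> (real^'d) set set \<Rightarrow> bool" where
  "mesh_in \<Omega> T \<longleftrightarrow> triangulation T \<and> T \<noteq> {} \<and>
     (\<forall>K\<in>T. int CARD('d) simplex K) \<and> \<Union>T \<subseteq> closure \<Omega>"

definition mesh_diameter :: "(real^'d::finite) set set \<Rightarrow> real" where
  "mesh_diameter T = Max (diameter ` T)"

text \<open>\<open>q\<close> is the number of subelements into which every element is divided. It is a real
  number because it is used with \<open>q = \<beta>^d\<close>.\<close>

definition regular_refinement ::
  "real \<Rightarrow> (real^'d::finite) set set \<Rightarrow> (real^'d) set set \<Rightarrow> bool" where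
  "regular_refinement q T T' \<longleftrightarrow>
     (\<forall>K'\<in>T'. \<exists>K\<in>T. K' \<subseteq> K) \<and>
     (\<forall>K\<in>T. \<Union>{K'\<in>T'. K' \<subseteq> K} = K \<and> real (card {K'\<in>T'. K' \<subseteq> K}) = q)"

text \<open>Continuity together with vanishing off \<open>\<Union>T\<close> yields the zero boundary values.\<close>

definition linear_fe_space :: "(real^'d::finite) set set \<Rightarrow> (real^'d \<Rightarrow> real) set" where
  "linear_fe_space T = {v. continuous_on UNIV v \<and> (\<forall>x. x \<notin> \<Union>T \<longrightarrow> v x = 0) \<and>
     (\<forall>K\<in>T. \<exists>a b. \<forall>x\<in>K. v x = a \<bullet> x + b)}"

text \<open>\<open>nested_meshes \<Omega> \<beta> n TH T\<close>: \<open>TH\<close> is the coarse mesh and \<open>T 1, \<dots>, T n\<close> are the meshes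
  of the levels.\<close>

definition nested_meshes ::
  "(real^'d::finite) set \<Rightarrow> real \<Rightarrow> nat \<Rightarrow> (real^'d) set set \<Rightarrow> (nat \<Rightarrow> (real^'d) set set) \<Rightarrow> bool"
  where
  "nested_meshes \<Omega> \<beta> n TH T \<longleftrightarrow>
     mesh_in \<Omega> TH \<and> (\<forall>k\<in>{1..n}. mesh_in \<Omega> (T k)) \<and>
     (\<exists>q. regular_refinement q TH (T 1)) \<and>
     (\<forall>k\<in>{2..n}. regular_refinement (\<beta> ^ CARD('d)) (T (k - 1)) (T k)) \<and>
     linear_fe_space TH \<subseteq> linear_fe_space (T 1) \<and>
     (\<forall>k\<in>{2..n}. linear_fe_space (T (k - 1)) \<subset> linear_fe_space (T k)) \<and>
     linear_fe_space (T n) \<subset> H10 \<Omega>"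

abbreviation level_dim :: "(real^'d::finite) set set \<Rightarrow> real" where
  "level_dim T \<equiv> real (fun_space.dim (linear_fe_space T))"


section \<open>The full multigrid scheme\<close>

definition enriched_space ::
  "(real^'d::finite \<Rightarrow> real) set \<Rightarrow> (real^'d \<Rightarrow> real) \<Rightarrow> (real^'d \<Rightarrow> real) set" where
  "enriched_space VH u = {v + w | v w. v \<in> VH \<and> w \<in> fun_space.span {u}}"

text \<open>One correction step from \<open>u\<close> to \<open>u'\<close>: \<open>y 0, \<dots>, y m\<close> are the multigrid iterates and
  \<open>z 0, \<dots>, z \<nu>\<close> those of the nonlinear iteration. The bound with \<open>\<theta>\<close> concerns
  all \<open>m\<close> multigrid iterations together.\<close>

definition correction_step ::
  "(real^'d::finite) set \<Rightarrow> (real^'d \<Rightarrow> real^'d^'d) \<Rightarrow> (real^'d \<Rightarrow> real \<Rightarrow> real) \<Rightarrow>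
     (real^'d \<Rightarrow> real) \<Rightarrow> real \<Rightarrow> nat \<Rightarrow> nat \<Rightarrow> (real^'d \<Rightarrow> real) set \<Rightarrow> (real^'d \<Rightarrow> real) set \<Rightarrow>
     (real^'d \<Rightarrow> real) \<Rightarrow> (nat \<Rightarrow> real^'d \<Rightarrow> real) \<Rightarrow> (nat \<Rightarrow> real^'d \<Rightarrow> real) \<Rightarrow>
     (real^'d \<Rightarrow> real) \<Rightarrow> bool" where
  "correction_step \<Omega> A f g \<theta> m \<nu> VH V u y z u' \<longleftrightarrow>
     y 0 = u \<and> (\<forall>i\<le>m. y i \<in> V) \<and>
     (\<exists>u_hat. linearised_solution \<Omega> A f g V u u_hat \<and>
        energy_norm \<Omega> A (y m - u_hat) \<le> \<theta> * energy_norm \<Omega> A (u - u_hat)) \<and>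
     (\<forall>s\<le>\<nu>. z s \<in> enriched_space VH (y m)) \<and> z \<nu> = u' \<and>
     semilinear_solution \<Omega> A f g (enriched_space VH (y m)) u'"

text \<open>The indices are the level, the correction step, and the inner iteration.\<close>

record 'v fmg_run =
  level_sol :: "nat \<Rightarrow> 'v"
  iterate :: "nat \<Rightarrow> nat \<Rightarrow> 'v"
  mg_iterate :: "nat \<Rightarrow> nat \<Rightarrow> nat \<Rightarrow> 'v"
  nonlin_iterate :: "nat \<Rightarrow> nat \<Rightarrow> nat \<Rightarrow> 'v"

definition full_multigrid_run ::
  "(real^'d::finite) set \<Rightarrow> (real^'d \<Rightarrow> real^'d^'d) \<Rightarrow> (real^'d \<Rightarrow> real \<Rightarrow> real) \<Rightarrow>
     (real^'d \<Rightarrow> real) \<Rightarrow> real \<Rightarrow> nat \<Rightarrow> nat \<Rightarrow> nat \<Rightarrow> nat \<Rightarrow>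
     (real^'d \<Rightarrow> real) set \<Rightarrow> (nat \<Rightarrow> (real^'d \<Rightarrow> real) set) \<Rightarrow>
     (real^'d \<Rightarrow> real) fmg_run \<Rightarrow> bool" where
  "full_multigrid_run \<Omega> A f g \<theta> m p \<nu> n VH V R \<longleftrightarrow>
     semilinear_solution \<Omega> A f g (V 1) (level_sol R 1) \<and>
     (\<forall>k\<in>{2..n}.
        iterate R k 0 = level_sol R (k - 1) \<and>
        (\<forall>l<p. correction_step \<Omega> A f g \<theta> m \<nu> VH (V k) (iterate R k l)
                 (mg_iterate R k l) (nonlin_iterate R k l) (iterate R k (Suc l))) \<and>
        level_sol R k = iterate R k p)"


section \<open>Work\<close>

text \<open>The work performed by one computing node, indexed as in \<open>fmg_run\<close>. The assembly of the
  matrices on the enriched spaces is separate from \<open>solve_work\<close>.\<close>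

record node_work =
  initial_work :: real
  mg_work :: "nat \<Rightarrow> nat \<Rightarrow> nat \<Rightarrow> real"
  solve_work :: "nat \<Rightarrow> nat \<Rightarrow> real"
  assembly_work :: "nat \<Rightarrow> nat \<Rightarrow> nat \<Rightarrow> real"

definition nonneg_work :: "node_work \<Rightarrow> bool" where
  "nonneg_work W \<longleftrightarrow> 0 \<le> initial_work W \<and> (\<forall>k l i. 0 \<le> mg_work W k l i) \<and>
     (\<forall>k l. 0 \<le> solve_work W k l) \<and> (\<forall>k l s. 0 \<le> assembly_work W k l s)"

definition total_work :: "nat \<Rightarrow> nat \<Rightarrow> nat \<Rightarrow> nat \<Rightarrow> node_work \<Rightarrow> real" where
  "total_work m p \<nu> n W = initial_work W +
     (\<Sum>k=2..n. \<Sum>l<p. (\<Sum>i<m. mg_work W k l i) + solve_work W k l +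
        (\<Sum>s<\<nu>. assembly_work W k l s))"

end

theory Submission
  imports Defs
begin

text \<open>Summing over the levels, the terms of size \<open>N\<^sub>k\<close> form a geometric series dominated by
  \<open>N\<^sub>n\<close>, while the solving cost \<open>M\<^sub>H\<close> is paid once per correction step, hence \<open>p (n - 1)\<close>
  times. The number of levels is \<open>O(log N\<^sub>n)\<close> because \<open>N\<^sub>n\<close> grows geometrically; this needs a
  positive dimension to start from. It is taken on level 2, as the strict inclusion
  \<open>V\<^sub>1 \<subset> V\<^sub>2\<close> forces \<open>V\<^sub>2 \<noteq> {0}\<close>, whereas \<open>V\<^sub>1\<close> might a priori be trivial.\<close>

section \<open>Finite dimension and nontriviality of the level spaces\<close>

lemma sum_fun_apply: "(\<Sum>i\<in>I. F i) x = (\<Sum>i\<in>I. F i x)"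
  for F :: "'i \<Rightarrow> 'a \<Rightarrow> 'b::comm_monoid_add"
  by (induction I rule: infinite_finite_induct) auto

text \<open>The elements of a mesh overlap on their faces; the chosen element \<open>\<kappa> x\<close> containing \<open>x\<close>
  makes the decomposition into affine pieces disjoint.\<close>

lemma linear_fe_space_finite_span:
  fixes T :: "(real^'d::finite) set set"
  assumes "finite T"
  obtains S :: "(real^'d \<Rightarrow> real) set"
  where "finite S" "linear_fe_space T \<subseteq> fun_space.span S"
proof -
  define \<kappa> where "\<kappa> x = (SOME K. K \<in> T \<and> x \<in> K)" for x
  have \<kappa>: "\<kappa> x \<in> T" "x \<in> \<kappa> x" if "x \<in> \<Union>T" for x
    using that someI_ex[of "\<lambda>K. K \<in> T \<and> x \<in> K"] by (auto simp: \<kappa>_def)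
  define I where "I K x = (if x \<in> \<Union>T \<and> \<kappa> x = K then 1 else 0 :: real)" for K x
  define J where "J K i x = I K x * x $ i" for K i and x :: "real^'d"
  \<comment> \<open>One indicator and its products with the coordinate functions for each element.
    These functions may be discontinuous: they only have to span a space containing
    \<open>linear_fe_space T\<close>.\<close>
  define S where "S = I ` T \<union> (\<lambda>(K, i). J K i) ` (T \<times> UNIV)"
  have "v \<in> fun_space.span S" if "v \<in> linear_fe_space T" for v
  proof -
    have v0: "v x = 0" if "x \<notin> \<Union>T" for x
      using \<open>v \<in> linear_fe_space T\<close> that by (simp add: linear_fe_space_def)
    have "\<forall>K\<in>T. \<exists>a b. \<forall>x\<in>K. v x = a \<bullet> x + b"
      using \<open>v \<in> linear_fe_space T\<close> by (simp add: linear_fe_space_def)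
    then obtain a b where ab: "\<And>K x. K \<in> T \<Longrightarrow> x \<in> K \<Longrightarrow> v x = a K \<bullet> x + b K"
      by metis
    let ?w = "\<Sum>K\<in>T. (\<lambda>x. b K * I K x) + (\<Sum>i\<in>UNIV. (\<lambda>x. a K $ i * J K i x))"
    have "v x = ?w x" for x
    proof (cases "x \<in> \<Union>T")
      case True
      have "?w x = (\<Sum>K\<in>T. I K x * (a K \<bullet> x + b K))"
        by (simp add: sum_fun_apply J_def inner_vec_def sum_distrib_left algebra_simps)
      \<comment> \<open>At a given point only the summand of the chosen element survives, even on a
        face shared by several elements.\<close>
      also have "\<dots> = (\<Sum>K\<in>T. if \<kappa> x = K then a K \<bullet> x + b K else 0)"
        using True by (intro sum.cong) (auto simp: I_def)
      also have "\<dots> = v x"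
        using \<open>finite T\<close> \<kappa>[OF True] ab by simp
      finally show ?thesis ..
    next
      case False
      then show ?thesis by (simp add: v0 sum_fun_apply I_def J_def)
    qed
    then have "v = ?w" by (rule ext)
    also have "?w \<in> fun_space.span S"
      by (intro fun_space.span_sum fun_space.span_add fun_space.span_scale fun_space.span_base)
        (auto simp: S_def)
    finally show ?thesis .
  qed
  moreover have "finite S"
    using \<open>finite T\<close> by (simp add: S_def)
  ultimately show thesis using that by blast
qed

text \<open>The finite spanning set matters: \<open>dim\<close> is 0 on infinite-dimensional spaces.\<close>

lemma level_dim_ge_1:
  fixes T :: "(real^'d::finite) set set"
  assumes "finite T" "v \<in> linear_fe_space T" "v \<noteq> 0"
  shows "level_dim T \<ge> 1"
proof -
  obtain S :: "(real^'d \<Rightarrow> real) set"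
    where S: "finite S" "linear_fe_space T \<subseteq> fun_space.span S"
    using linear_fe_space_finite_span[OF \<open>finite T\<close>] by blast
  obtain B where B: "B \<subseteq> linear_fe_space T" "fun_space.independent B"
    "linear_fe_space T \<subseteq> fun_space.span B"
    "card B = fun_space.dim (linear_fe_space T)"
    using fun_space.basis_exists[of "linear_fe_space T"] by blast
  have "finite B"
    using fun_space.independent_span_bound[OF S(1) B(2)] B(1) S(2) by blast
  \<comment> \<open>An empty \<open>B\<close> would span only 0, whereas \<open>v\<close> is a
    nonzero element of its span.\<close>
  moreover have "B \<noteq> {}"
    using assms B(3) by auto
  ultimately have "card B \<ge> 1"
    by (simp add: Suc_le_eq card_gt_0_iff)
  then show ?thesis using B(4) by simp
qed

lemma nested_meshes_level_dim_ge_1: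
  assumes "nested_meshes \<Omega> \<beta> n TH T" "n \<ge> 2"
  shows "level_dim (T 2) \<ge> 1"
proof -
  have "linear_fe_space (T (2 - 1)) \<subset> linear_fe_space (T 2)"
    using assms unfolding nested_meshes_def by (meson atLeastAtMost_iff order_refl)
  moreover have "0 \<in> linear_fe_space (T (2 - 1))"
    by (auto simp: linear_fe_space_def intro!: exI[of _ 0])
  ultimately obtain v where "v \<in> linear_fe_space (T 2)" "v \<noteq> 0"
    by auto
  moreover have "finite (T 2)"
    using assms by (auto simp: nested_meshes_def mesh_in_def triangulation_def)
  ultimately show ?thesis by (rule level_dim_ge_1[rotated])
qed

section \<open>Geometric decay and growth across the levels\<close>

lemma sum_geometric_levels_le:
  fixes r :: real
  assumes "r > 1" "a \<ge> 1"
  shows "(\<Sum>k=2..n. 1 / r ^ (a * (n - k))) \<le> r / (r - 1)"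
proof -
  \<comment> \<open>Since \<open>a\<close> is at least 1, replacing it by 1 only enlarges the terms.
    Counted down from the finest level, they form an initial piece of the geometric series.\<close>
  have "(\<Sum>k=2..n. 1 / r ^ (a * (n - k))) \<le> (\<Sum>k=2..n. (1 / r) ^ (n - k))"
    using assms by (intro sum_mono) (auto simp: power_divide field_simps intro!: power_increasing)
  also have "\<dots> = (\<Sum>j\<in>(\<lambda>k. n - k) ` {2..n}. (1 / r) ^ j)"
    by (subst sum.reindex) (auto simp: inj_on_def)
  also have "\<dots> \<le> (\<Sum>j. (1 / r) ^ j)"
    using assms by (intro sum_le_suminf summable_geometric) auto
  also have "\<dots> = r / (r - 1)"
    using assms by (subst suminf_geometric) (auto simp: field_simps)
  finally show ?thesis .
qed

text \<open>Taking logarithms bounds \<open>n * ln r\<close> by \<open>ln (N n) - ln b\<close>. This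
  is what turns the number of levels into a logarithm of the dimension.\<close>

lemma geometric_growth_imp_le_ln:
  fixes N :: "nat \<Rightarrow> real"
  assumes "r > 1" "b > 0" and growth: "\<forall>\<^sub>F n in sequentially. b * r ^ n \<le> N n"
  shows "\<exists>L>0. \<forall>\<^sub>F n in sequentially. real n \<le> L * ln (N n)"
proof (intro exI conjI)
  have "ln r > 0" using \<open>r > 1\<close> by simp
  \<comment> \<open>The factor 2 leaves half of \<open>n * ln r\<close> to absorb
    \<open>ln b\<close>, which may be negative; this works as soon as \<open>n\<close> is
    large.\<close>
  then show "2 / ln r > 0" by simp
  have "\<forall>\<^sub>F n in sequentially. - 2 * ln b / ln r \<le> real n"
    using filterlim_real_sequentially filterlim_at_top by blast
  with growth show "\<forall>\<^sub>F n in sequentially. real n \<le> 2 / ln r * ln (N n)"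
  proof eventually_elim
    case (elim n)
    have "ln b + n * ln r = ln (b * r ^ n)"
      using assms by (simp add: ln_mult ln_realpow)
    also have "\<dots> \<le> ln (N n)"
      using elim(1) assms by (intro ln_mono) (auto intro: less_le_trans[OF _ elim(1)])
    finally have "ln b + n * ln r \<le> ln (N n)" .
    moreover have "- 2 * ln b \<le> n * ln r"
      using elim(2) \<open>ln r > 0\<close> by (simp add: field_simps)
    ultimately have "n * ln r \<le> 2 * ln (N n)" by linarith
    then show ?case using \<open>ln r > 0\<close> by (simp add: field_simps)
  qed
qed

section \<open>Summation of the work\<close>

text \<open>Bookkeeping for one fixed \<open>n\<close>: the sum of the \<open>N k\<close> is left
  unevaluated, so no growth of the dimensions enters yet. The factor \<open>n - 1\<close> counts the
  levels from 2 to \<open>n\<close>.\<close>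

lemma total_work_le:
  fixes N :: "nat \<Rightarrow> real"
  assumes initial: "initial_work W \<le> C\<^sub>i * M\<^sub>1"
    and mg: "\<And>k l i. k \<in> {2..n} \<Longrightarrow> l < p \<Longrightarrow> i < m \<Longrightarrow> mg_work W k l i \<le> C\<^sub>m * N k"
    and solve: "\<And>k l. k \<in> {2..n} \<Longrightarrow> l < p \<Longrightarrow> solve_work W k l \<le> C\<^sub>s * M"
    and assembly: "\<And>k l s. k \<in> {2..n} \<Longrightarrow> l < p \<Longrightarrow> s < \<nu> \<Longrightarrow>
      assembly_work W k l s \<le> C\<^sub>a * (N k / t)"
  shows "total_work m p \<nu> n W \<le>
    C\<^sub>i * M\<^sub>1 + p * ((m * C\<^sub>m + C\<^sub>a * (\<nu> / t)) * (\<Sum>k=2..n. N k)) + p * (C\<^sub>s * M * real (n - 1))"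
proof -
  have "(\<Sum>l<p. (\<Sum>i<m. mg_work W k l i) + solve_work W k l + (\<Sum>s<\<nu>. assembly_work W k l s))
      \<le> p * ((m * C\<^sub>m + C\<^sub>a * (\<nu> / t)) * N k + C\<^sub>s * M)" if k: "k \<in> {2..n}" for k
  proof -
    have "(\<Sum>i<m. mg_work W k l i) + solve_work W k l + (\<Sum>s<\<nu>. assembly_work W k l s)
        \<le> (m * C\<^sub>m + C\<^sub>a * (\<nu> / t)) * N k + C\<^sub>s * M" if l: "l < p" for l
    proof -
      have "(\<Sum>i<m. mg_work W k l i) \<le> m * (C\<^sub>m * N k)"
        using sum_bounded_above[of "{..<m}" "mg_work W k l" "C\<^sub>m * N k"] mg[OF k l] by simp
      moreover have "(\<Sum>s<\<nu>. assembly_work W k l s) \<le> \<nu> * (C\<^sub>a * (N k / t))"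
        using sum_bounded_above[of "{..<\<nu>}" "assembly_work W k l" "C\<^sub>a * (N k / t)"]
          assembly[OF k l] by simp
      ultimately show ?thesis
        using solve[OF k l] by (simp add: algebra_simps)
    qed
    then show ?thesis
      using sum_bounded_above[of "{..<p}" _ "(m * C\<^sub>m + C\<^sub>a * (\<nu> / t)) * N k + C\<^sub>s * M"] by simp
  qed
  then have "total_work m p \<nu> n W \<le>
      C\<^sub>i * M\<^sub>1 + (\<Sum>k=2..n. p * ((m * C\<^sub>m + C\<^sub>a * (\<nu> / t)) * N k + C\<^sub>s * M))"
    unfolding total_work_def by (intro add_mono initial sum_mono) auto
  also have "(\<Sum>k=2..n. p * ((m * C\<^sub>m + C\<^sub>a * (\<nu> / t)) * N k + C\<^sub>s * M)) =
      p * ((m * C\<^sub>m + C\<^sub>a * (\<nu> / t)) * (\<Sum>k=2..n. N k)) + p * (C\<^sub>s * M * real (n - 1))"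
    by (simp add: sum.distrib flip: sum_distrib_left) (simp add: algebra_simps)
  finally show ?thesis by (simp add: add.assoc)
qed

text \<open>The constants in the cost hypotheses carry no sign. As upper bounds they may be
  enlarged, and nonnegative ones make the later estimates monotone.\<close>

lemma ex_nonneg_const:
  assumes "\<exists>C. P C" "\<And>C C' :: real. P C \<Longrightarrow> C \<le> C' \<Longrightarrow> P C'"
  obtains C where "C \<ge> 0" "P C"
  using assms by (metis max.cobounded1 max.cobounded2)

text \<open>The constant may depend on \<open>m\<close> and \<open>p\<close>, which are fixed before
  \<open>n\<close>. In contrast \<open>iters n\<close> and \<open>nodes n\<close> vary with
  \<open>n\<close>, so their quotient has to stay visible in the bound.\<close>

theorem theorem3p3:
  fixes \<Omega> :: "(real^'d::finite) set"
    and A :: "real^'d \<Rightarrow> real^'d^'d" and f :: "real^'d \<Rightarrow> real \<Rightarrow> real" and g :: "real^'d \<Rightarrow> real"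
    and \<beta> \<theta> :: real and m p :: nat
    and TH :: "nat \<Rightarrow> (real^'d) set set" and T :: "nat \<Rightarrow> nat \<Rightarrow> (real^'d) set set"
    and h N :: "nat \<Rightarrow> nat \<Rightarrow> real"
    and R :: "nat \<Rightarrow> (real^'d \<Rightarrow> real) fmg_run"
    and nodes iters :: "nat \<Rightarrow> nat"
    and W :: "nat \<Rightarrow> nat \<Rightarrow> node_work"
    and M_H M_h1 :: "nat \<Rightarrow> real"
  assumes dim: "CARD('d) = 2 \<or> CARD('d) = 3"
    and domain: "convex_lipschitz_domain \<Omega>"
    and coefficient: "admissible_coefficient \<Omega> A"
    and nonlinearity: "admissible_nonlinearity \<Omega> f"
    and source: "admissible_source \<Omega> g"
    and "\<beta> > 1" and "\<theta> < 1"
    and meshes: "\<And>n. n \<ge> 1 \<Longrightarrow> nested_meshes \<Omega> \<beta> n (TH n) (T n)"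
    and h_pos: "\<And>n k. 1 \<le> k \<Longrightarrow> k \<le> n \<Longrightarrow> h n k > 0"
    and h_step: "\<And>n k. 2 \<le> k \<Longrightarrow> k \<le> n \<Longrightarrow> h n k = h n (k - 1) / \<beta>"
    and h_size: "\<exists>c>0. \<exists>C. \<forall>n. \<forall>k\<in>{1..n}.
      c * h n k \<le> mesh_diameter (T n k) \<and> mesh_diameter (T n k) \<le> C * h n k"
    and N_def: "\<And>n k. N n k = level_dim (T n k)"
    and N_equiv: "\<exists>c>0. \<exists>C. \<forall>n. \<forall>k\<in>{1..n}.
      c * (N n n / \<beta> ^ (CARD('d) * (n - k))) \<le> N n k \<and>
      N n k \<le> C * (N n n / \<beta> ^ (CARD('d) * (n - k)))"
    and run: "\<And>n. n \<ge> 1 \<Longrightarrow> full_multigrid_run \<Omega> A f g \<theta> m p (iters n) n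
      (linear_fe_space (TH n)) (\<lambda>k. linear_fe_space (T n k)) (R n)"
    and nodes: "\<And>n. nodes n \<ge> 1"
    and M_nonneg: "\<And>n. M_H n \<ge> 0" "\<And>n. M_h1 n \<ge> 0"
    and work_nonneg: "\<And>n j. nonneg_work (W n j)"
    and initial_cost: "\<exists>C. \<forall>n\<ge>1. \<forall>j<nodes n. initial_work (W n j) \<le> C * M_h1 n"
    and mg_cost: "\<exists>C. \<forall>n. \<forall>j<nodes n. \<forall>k\<in>{2..n}. \<forall>l<p. \<forall>i<m.
      mg_work (W n j) k l i \<le> C * N n k"
    and solve_cost: "\<exists>C. \<forall>n. \<forall>j<nodes n. \<forall>k\<in>{2..n}. \<forall>l<p.
      solve_work (W n j) k l \<le> C * M_H n"
    and assembly_cost: "\<exists>C. \<forall>n. \<forall>j<nodes n. \<forall>k\<in>{2..n}. \<forall>l<p. \<forall>s<iters n.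
      assembly_work (W n j) k l s \<le> C * (N n k / nodes n)"
  shows "\<exists>C>0. \<forall>\<^sub>F n in sequentially. \<forall>j<nodes n.
    total_work m p (iters n) n (W n j) \<le>
      C * ((1 + iters n / nodes n) * N n n + M_H n * ln (N n n) + M_h1 n)"
proof -
  let ?d = "CARD('d)"
  have N_nonneg: "N n k \<ge> 0" for n k by (simp add: N_def)
  obtain C\<^sub>i where Ci: "C\<^sub>i \<ge> 0" "\<forall>n\<ge>1. \<forall>j<nodes n. initial_work (W n j) \<le> C\<^sub>i * M_h1 n"
    by (rule ex_nonneg_const[OF initial_cost])
      (meson M_nonneg(2) mult_right_mono order_trans)
  obtain C\<^sub>m where Cm: "C\<^sub>m \<ge> 0" "\<forall>n. \<forall>j<nodes n. \<forall>k\<in>{2..n}. \<forall>l<p. \<forall>i<m.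
      mg_work (W n j) k l i \<le> C\<^sub>m * N n k"
    by (rule ex_nonneg_const[OF mg_cost]) (meson N_nonneg mult_right_mono order_trans)
  obtain C\<^sub>s where Cs: "C\<^sub>s \<ge> 0" "\<forall>n. \<forall>j<nodes n. \<forall>k\<in>{2..n}. \<forall>l<p.
      solve_work (W n j) k l \<le> C\<^sub>s * M_H n"
    by (rule ex_nonneg_const[OF solve_cost]) (meson M_nonneg(1) mult_right_mono order_trans)
  have quot_nonneg: "N n k / nodes n \<ge> 0" for n k by (simp add: N_nonneg)
  obtain C\<^sub>a where Ca: "C\<^sub>a \<ge> 0" "\<forall>n. \<forall>j<nodes n. \<forall>k\<in>{2..n}. \<forall>l<p. \<forall>s<iters n.
      assembly_work (W n j) k l s \<le> C\<^sub>a * (N n k / nodes n)"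
    by (rule ex_nonneg_const[OF assembly_cost])
      (meson quot_nonneg mult_right_mono order_trans)
  \<comment> \<open>This upper bound serves twice: summed over the levels it gives the geometric
    series, and at level 2 it forces \<open>N n n\<close> to grow. Passing to \<open>max D 1\<close>
    secures a positive constant.\<close>
  obtain D where "\<forall>n. \<forall>k\<in>{1..n}. N n k \<le> D * (N n n / \<beta> ^ (?d * (n - k)))"
    using N_equiv by blast
  then have "\<forall>n. \<forall>k\<in>{1..n}. N n k \<le> max D 1 * (N n n / \<beta> ^ (?d * (n - k)))"
    using \<open>\<beta> > 1\<close> N_nonneg
    by (meson max.cobounded1 mult_right_mono order_trans divide_nonneg_nonneg zero_le_power
        less_imp_le zero_less_one order_less_trans)
  then obtain D where D: "D > 0"
    "\<And>n k. k \<in> {1..n} \<Longrightarrow> N n k \<le> D * (N n n / \<beta> ^ (?d * (n - k)))"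
    by (metis less_max_iff_disj zero_less_one)

  define S where "S = D * (\<beta> / (\<beta> - 1))"
  have "S \<ge> 0" using D(1) \<open>\<beta> > 1\<close> by (simp add: S_def)
  have sum_N: "(\<Sum>k=2..n. N n k) \<le> S * N n n" for n
  proof -
    have "(\<Sum>k=2..n. N n k) \<le> (\<Sum>k=2..n. D * (N n n / \<beta> ^ (?d * (n - k))))"
      by (intro sum_mono D(2)) auto
    also have "\<dots> = D * N n n * (\<Sum>k=2..n. 1 / \<beta> ^ (?d * (n - k)))"
      by (simp add: sum_distrib_left)
    also have "\<dots> \<le> D * N n n * (\<beta> / (\<beta> - 1))"
      using D(1) \<open>\<beta> > 1\<close> N_nonneg
      by (intro mult_left_mono sum_geometric_levels_le) (auto simp: Suc_le_eq)
    finally show ?thesis by (simp add: S_def mult_ac)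
  qed

  \<comment> \<open>The upper bound on \<open>N n 2\<close>, combined with \<open>N n 2\<close>
    being at least 1, is read as a lower bound on \<open>N n n\<close>. The factor
    \<open>\<beta>\<^sup>2\<close> compensates for starting at level 2.\<close>
  have "1 / (D * \<beta>\<^sup>2) * \<beta> ^ n \<le> N n n" if "n \<ge> 2" for n
  proof -
    have "1 \<le> N n 2"
      using nested_meshes_level_dim_ge_1[OF meshes] that by (simp add: N_def)
    also have "\<dots> \<le> D * (N n n / \<beta> ^ (?d * (n - 2)))"
      using that by (intro D(2)) auto
    finally have "\<beta> ^ (?d * (n - 2)) \<le> D * N n n"
      using \<open>\<beta> > 1\<close> by (simp add: field_simps)
    moreover have "\<beta> ^ (n - 2) \<le> \<beta> ^ (?d * (n - 2))"
      using \<open>\<beta> > 1\<close> by (intro power_increasing) (auto simp: Suc_le_eq)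
    ultimately have "\<beta> ^ (n - 2) \<le> D * N n n" by (rule order_trans[rotated])
    moreover have "\<beta> ^ n = \<beta> ^ (n - 2) * \<beta>\<^sup>2"
      using that by (simp only: le_add_diff_inverse2 flip: power_add)
    ultimately show ?thesis
      using \<open>\<beta> > 1\<close> D(1) by (simp add: field_simps)
  qed
  then have "\<forall>\<^sub>F n in sequentially. 1 / (D * \<beta>\<^sup>2) * \<beta> ^ n \<le> N n n"
    using eventually_sequentially by blast
  then obtain L where L: "L > 0" "\<forall>\<^sub>F n in sequentially. real n \<le> L * ln (N n n)"
    using geometric_growth_imp_le_ln[of \<beta> "1 / (D * \<beta>\<^sup>2)" "\<lambda>n. N n n"] D(1) \<open>\<beta> > 1\<close> by auto

  \<comment> \<open>The sum of all coefficients that occur below, so that each of them is at most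
    \<open>C\<close>; the leading 1 makes it positive.\<close>
  define C where "C = 1 + C\<^sub>i + p * (m * C\<^sub>m * S) + p * (C\<^sub>a * S) + p * (C\<^sub>s * L)"
  have "C > 0"
    using Ci(1) Cm(1) Cs(1) Ca(1) \<open>S \<ge> 0\<close> L(1) by (simp add: C_def add_pos_nonneg)
  have C_ge: "C\<^sub>i \<le> C" "p * (m * C\<^sub>m * S) + p * (C\<^sub>a * S) \<le> C" "p * (C\<^sub>s * L) \<le> C"
    using Ci(1) Cm(1) Cs(1) Ca(1) \<open>S \<ge> 0\<close> L(1) by (simp_all add: C_def)
  have "\<forall>\<^sub>F n in sequentially. \<forall>j<nodes n. total_work m p (iters n) n (W n j) \<le>
      C * ((1 + iters n / nodes n) * N n n + M_H n * ln (N n n) + M_h1 n)"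
    using L(2) eventually_ge_at_top[of 1]
  proof eventually_elim
    case (elim n)
    define \<rho> where "\<rho> = real (iters n) / nodes n"
    have "\<rho> \<ge> 0" by (simp add: \<rho>_def)
    \<comment> \<open>Forced by \<open>L > 0\<close> and the bound of the nonnegative number
      \<open>real n\<close> by \<open>L * ln (N n n)\<close>.\<close>
    have "ln (N n n) \<ge> 0"
      using elim(1) L(1) by (metis of_nat_0_le_iff order_trans zero_le_mult_iff not_le)
    show ?case
    proof (intro allI impI)
      fix j assume "j < nodes n"
      have "total_work m p (iters n) n (W n j) \<le> C\<^sub>i * M_h1 n +
          p * ((m * C\<^sub>m + C\<^sub>a * \<rho>) * (\<Sum>k=2..n. N n k)) + p * (C\<^sub>s * M_H n * real (n - 1))"
        unfolding \<rho>_def using Ci(2) Cm(2) Cs(2) Ca(2) elim(2) \<open>j < nodes n\<close>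
        by (intro total_work_le) auto
      \<comment> \<open>The level count is handled by \<open>n - 1\<close> being at most
        \<open>n\<close>, hence at most \<open>L * ln (N n n)\<close>.\<close>
      also have "\<dots> \<le> C\<^sub>i * M_h1 n +
          p * ((m * C\<^sub>m + C\<^sub>a * \<rho>) * (S * N n n)) + p * (C\<^sub>s * M_H n * (L * ln (N n n)))"
        using Cm(1) Cs(1) Ca(1) \<open>\<rho> \<ge> 0\<close> M_nonneg elim(1)
        by (intro add_mono mult_left_mono sum_N order_refl) auto
      \<comment> \<open>Nonnegative terms are added to complete the product with
        \<open>1 + \<rho>\<close>: \<open>\<rho>\<close> times the multigrid part and once the
        assembly coefficient times \<open>N n n\<close>.\<close>
      also have "\<dots> \<le> C\<^sub>i * M_h1 n +
          (p * (m * C\<^sub>m * S) + p * (C\<^sub>a * S)) * ((1 + \<rho>) * N n n) +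
          p * (C\<^sub>s * L) * (M_H n * ln (N n n))"
        using Cm(1) Ca(1) \<open>S \<ge> 0\<close> \<open>\<rho> \<ge> 0\<close> N_nonneg[of n n]
        by (simp add: algebra_simps)
      also have "\<dots> \<le> C * M_h1 n + C * ((1 + \<rho>) * N n n) + C * (M_H n * ln (N n n))"
        using M_nonneg N_nonneg \<open>\<rho> \<ge> 0\<close> \<open>ln (N n n) \<ge> 0\<close>
        by (intro add_mono mult_right_mono C_ge) auto
      also have "\<dots> = C * ((1 + \<rho>) * N n n + M_H n * ln (N n n) + M_h1 n)"
        by (simp add: algebra_simps)
      finally show "total_work m p (iters n) n (W n j) \<le>
          C * ((1 + iters n / nodes n) * N n n + M_H n * ln (N n n) + M_h1 n)"
        by (simp add: \<rho>_def)
    qed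
  qed
  with \<open>C > 0\<close> show ?thesis by blast
qed

end
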